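(* Let $P$ be an $n\times m$ non-negative real matrix without zero columns, and let $k=\mathrm{rk}_+(P)$. Then there exists $\epsilon>0$ such that $\mathrm{rk}_+(N)\geq k$ for all $N\in B(P,\epsilon)$.
   Context: A non-negative $n\times m$ matrix is a real matrix $(p_{i,j})$ with all entries $p_{i,j}\ge 0$; the set of these is denoted $\mathbb{R}^{nm}_{\geq 0}$. The non-negative rank $\mathrm{rk}_+(P)$ of a non-negative $n\times m$ matrix $P$ is the smallest integer $k$ such that $P=c_1(r_1)^t+\ldots+c_k(r_k)^t$, where the column vectors $c_h\in\mathbb{R}^n$ and $r_h\in\mathbb{R}^m$ have non-negative entries. For a non-negative matrix $P=(p_{i,j})$ and $\epsilon>0$, the ball of center $P$ and radius $\epsilon$ (with respect to the Frobenius norm, inside the non-negative matrices) is $$B(P,\epsilon)=\left\{N=(n_{i,j})\in\mathbb{R}^{nm}_{\geq 0} : \sqrt{\sum_{i,j} (p_{i,j}-n_{i,j})^2}<\epsilon\right\}.$$ *)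

theory Defs
  imports "HOL-Analysis.Analysis"
begin

text \<open>An \<open>n \<times> m\<close> real matrix is an element of \<^typ>\<open>real ^ 'm ^ 'n\<close>
  (\<open>n\<close> rows, \<open>m\<close> columns).\<close>

definition nonneg_vec :: "real ^ 'n \<Rightarrow> bool" where
  "nonneg_vec v \<longleftrightarrow> (\<forall>i. 0 \<le> v $ i)"

definition nonneg_mat :: "real ^ 'm ^ 'n \<Rightarrow> bool" where
  "nonneg_mat P \<longleftrightarrow> (\<forall>i j. 0 \<le> P $ i $ j)"

definition outer_prod :: "real ^ 'n \<Rightarrow> real ^ 'm \<Rightarrow> real ^ 'm ^ 'n" where
  "outer_prod c r = (\<chi> i j. c $ i * r $ j)"

definition has_nonneg_decomp :: "real ^ 'm ^ 'n \<Rightarrow> nat \<Rightarrow> bool" where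
  "has_nonneg_decomp P k \<longleftrightarrow>
     (\<exists>(c :: nat \<Rightarrow> real ^ 'n) (r :: nat \<Rightarrow> real ^ 'm).
        (\<forall>h\<in>{1..k}. nonneg_vec (c h) \<and> nonneg_vec (r h)) \<and>
        P = (\<Sum>h=1..k. outer_prod (c h) (r h)))"

text \<open>The \<open>LEAST\<close> below is meaningful only for non-negative matrices; for these a
  decomposition always exists, as \<open>nonneg_mat_has_decomp\<close> shows.\<close>

definition nonneg_rank :: "real ^ 'm ^ 'n \<Rightarrow> nat" where
  "nonneg_rank P = (LEAST k. has_nonneg_decomp P k)"

lemma nonneg_mat_has_decomp:
  fixes P :: "real ^ 'm ^ 'n"
  assumes "nonneg_mat P"
  shows "has_nonneg_decomp P CARD('m)"
proof -
  obtain f :: "nat \<Rightarrow> 'm" where f: "bij_betw f {1..CARD('m)} UNIV"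
    using ex_bij_betw_nat_finite_1[of "UNIV :: 'm set"] by auto
  have "P = (\<Sum>j\<in>UNIV. outer_prod (column j P) (axis j 1))"
    by (simp add: vec_eq_iff outer_prod_def column_def axis_def if_distrib cong: if_cong)
  also have "\<dots> = (\<Sum>h=1..CARD('m). outer_prod (column (f h) P) (axis (f h) 1))"
    by (rule sum.reindex_bij_betw[OF f, symmetric])
  finally show ?thesis
    using assms unfolding has_nonneg_decomp_def nonneg_vec_def nonneg_mat_def
    by (intro exI[of _ "\<lambda>h. column (f h) P"] exI[of _ "\<lambda>h. axis (f h) 1"])
       (auto simp: column_def axis_def)
qed

definition nonneg_ball :: "real ^ 'm ^ 'n \<Rightarrow> real \<Rightarrow> (real ^ 'm ^ 'n) set" where
  "nonneg_ball P \<epsilon> =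
     {N. nonneg_mat N \<and> sqrt (\<Sum>i\<in>UNIV. \<Sum>j\<in>UNIV. (P $ i $ j - N $ i $ j)\<^sup>2) < \<epsilon>}"

end

theory Submission
  imports Defs
begin

text \<open>
  Nonnegative rank is lower semicontinuous because the matrices with a nonnegative
  decomposition into \<open>j\<close> terms form a closed set.
  The terms of a signed decomposition can be unbounded, with large terms cancelling.  Among
  nonnegative terms there is no cancellation: every term is bounded entrywise by the matrix
  itself.  A term \<open>c r\<^sup>t\<close> is unaffected by moving a positive scalar from \<open>c\<close> to \<open>r\<close>, and
  scaling the largest entry of \<open>c\<close> to \<open>1\<close> (\<open>outer_prod_max_normalized\<close>) turns the bound on the
  entries of \<open>c r\<^sup>t\<close> into a bound on \<open>r\<close>.

  So the decomposable matrices near \<open>P\<close> with fewer than \<open>k\<close> terms all lie in a finite union of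
  compact sets (\<open>bounded_nonneg_decomp_in_box_sums\<close>, \<open>compact_box_outer_prods\<close>,
  \<open>compact_indexed_sums\<close>).  These sets consist of matrices of nonnegative rank below \<open>k\<close>, hence
  miss \<open>P\<close>, and closedness yields a ball around \<open>P\<close> that misses all of them.
\<close>

lemma compact_indexed_sums:
  fixes K :: "'a::real_normed_vector set"
  assumes "compact K"
  shows "compact {\<Sum>h=1..k. X h | X. \<forall>h\<in>{1..k::nat}. X h \<in> K}"
proof (induction k)
  case 0
  show ?case by simp
next
  case (Suc k)
  let ?S = "{\<Sum>h=1..k. X h | X. \<forall>h\<in>{1..k::nat}. X h \<in> K}"
  have "{\<Sum>h=1..Suc k. X h | X. \<forall>h\<in>{1..Suc k}. X h \<in> K} = {x + y | x y. x \<in> ?S \<and> y \<in> K}"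
    (is "?L = ?R")
  proof
    show "?L \<subseteq> ?R"
    proof
      fix z assume "z \<in> ?L"
      then obtain X where X: "z = (\<Sum>h=1..Suc k. X h)" "\<forall>h\<in>{1..Suc k}. X h \<in> K" by blast
      have "z = (\<Sum>h=1..k. X h) + X (Suc k)" using X(1) by simp
      moreover have "(\<Sum>h=1..k. X h) \<in> ?S" using X(2) by auto
      moreover have "X (Suc k) \<in> K" using X(2) by simp
      ultimately show "z \<in> ?R" by blast
    qed
    show "?R \<subseteq> ?L"
    proof
      fix z assume "z \<in> ?R"
      then obtain X y where X: "z = (\<Sum>h=1..k. X h) + y" "\<forall>h\<in>{1..k}. X h \<in> K" "y \<in> K"
        by blast
      have "(\<Sum>h=1..k. (X(Suc k := y)) h) = (\<Sum>h=1..k. X h)"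
        by (intro sum.cong) auto
      then have "z = (\<Sum>h=1..Suc k. (X(Suc k := y)) h)" using X(1) by simp
      moreover have "\<forall>h\<in>{1..Suc k}. (X(Suc k := y)) h \<in> K" using X(2,3) by auto
      ultimately show "z \<in> ?L" by blast
    qed
  qed
  then show ?case using compact_sums[OF Suc assms] by simp
qed

definition box_outer_prods :: "real \<Rightarrow> (real ^ 'm ^ 'n) set" where
  "box_outer_prods M =
     (\<lambda>(c, r). outer_prod c r) ` (cbox 0 (\<chi> i. 1) \<times> cbox 0 (\<chi> j. M))"

lemma compact_box_outer_prods: "compact (box_outer_prods M :: (real ^ 'm ^ 'n) set)"
  unfolding box_outer_prods_def outer_prod_def case_prod_beta
  by (intro compact_continuous_image compact_Times compact_cbox continuous_intros)

text \<open>Dividing \<open>c\<close> by its largest entry and multiplying \<open>r\<close> by it leaves the product fixed.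
  If \<open>c = 0\<close>, this is impossible, but then \<open>r\<close> may be taken to be \<open>0\<close>.\<close>

lemma outer_prod_max_normalized:
  fixes c :: "real ^ 'n" and r :: "real ^ 'm"
  assumes c: "nonneg_vec c" and r: "nonneg_vec r"
  obtains c' r' where "outer_prod c' r' = outer_prod c r"
    and "c' \<in> cbox 0 (\<chi> i. 1)" and "nonneg_vec r'" and "r' = 0 \<or> (\<exists>i. c' $ i = 1)"
proof (cases "c = 0")
  case True
  show ?thesis
    by (rule that[of 0 0]) (auto simp: True outer_prod_def mem_box_cart nonneg_vec_def)
next
  case False
  define s where "s = Max (range (($) c))"
  have le: "c $ i \<le> s" for i unfolding s_def by simp
  have "s \<in> range (($) c)" unfolding s_def by (intro Max_in) auto
  then obtain i0 where i0: "c $ i0 = s" by auto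
  obtain i where "c $ i \<noteq> 0" using False by (auto simp: vec_eq_iff)
  then have s: "s > 0" using c le[of i] unfolding nonneg_vec_def
    by (metis less_eq_real_def order_less_le_trans)
  show ?thesis
  proof (rule that[of "\<chi> i. c $ i / s" "\<chi> j. s * r $ j"])
    show "outer_prod (\<chi> i. c $ i / s) (\<chi> j. s * r $ j) = outer_prod c r"
      using s by (simp add: outer_prod_def)
    show "(\<chi> i. c $ i / s) \<in> cbox 0 (\<chi> i. 1)"
      using s le c by (simp add: mem_box_cart nonneg_vec_def)
    show "nonneg_vec (\<chi> j. s * r $ j)" using s r by (simp add: nonneg_vec_def)
    show "(\<chi> j. s * r $ j) = 0 \<or> (\<exists>i. (\<chi> i. c $ i / s) $ i = 1)"
      using s i0 by (auto intro!: exI[of _ i0])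
  qed
qed

lemma nonneg_outer_prod:
  "nonneg_vec c \<Longrightarrow> nonneg_vec r \<Longrightarrow> 0 \<le> outer_prod c r $ i $ j"
  by (simp add: outer_prod_def nonneg_vec_def)

text \<open>The bound \<open>M\<close> on the entries of a product passes to \<open>r\<close> once \<open>c\<close> has an entry equal
  to \<open>1\<close>, since \<open>r\<^sup>t\<close> then occurs as a row of the product.\<close>

lemma bounded_outer_prod_in_box:
  fixes c :: "real ^ 'n" and r :: "real ^ 'm"
  assumes c: "nonneg_vec c" and r: "nonneg_vec r"
    and M: "\<And>i j. outer_prod c r $ i $ j \<le> M"
  shows "outer_prod c r \<in> box_outer_prods M"
proof -
  obtain c' r' where eq: "outer_prod c' r' = outer_prod c r"
    and c': "c' \<in> cbox 0 (\<chi> i. 1)" and r': "nonneg_vec r'"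
    and one: "r' = 0 \<or> (\<exists>i. c' $ i = 1)"
    using outer_prod_max_normalized[OF c r] by blast
  have "0 \<le> M" using nonneg_outer_prod[OF c r] M order_trans by blast
  have "r' $ j \<le> M" for j
    using one
  proof
    assume "r' = 0"
    then show ?thesis using \<open>0 \<le> M\<close> by simp
  next
    assume "\<exists>i. c' $ i = 1"
    then obtain i where "c' $ i = 1" by blast
    then have "r' $ j = outer_prod c' r' $ i $ j" by (simp add: outer_prod_def)
    then show ?thesis using M eq by simp
  qed
  then have "r' \<in> cbox 0 (\<chi> j. M)" using r' by (simp add: mem_box_cart nonneg_vec_def)
  then show ?thesis using c' unfolding box_outer_prods_def eq[symmetric] by auto
qed

text \<open>This is where nonnegativity excludes cancellation: no term exceeds the sum in any entry.\<close>

lemma bounded_nonneg_decomp_in_box_sums: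
  fixes N :: "real ^ 'm ^ 'n"
  assumes "has_nonneg_decomp N k" and M: "\<And>i j. N $ i $ j \<le> M"
  shows "N \<in> {\<Sum>h=1..k. X h | X. \<forall>h\<in>{1..k}. X h \<in> box_outer_prods M}"
proof -
  obtain c :: "nat \<Rightarrow> real ^ 'n" and r :: "nat \<Rightarrow> real ^ 'm"
    where nn: "\<forall>h\<in>{1..k}. nonneg_vec (c h) \<and> nonneg_vec (r h)"
      and N: "N = (\<Sum>h=1..k. outer_prod (c h) (r h))"
    using assms(1) unfolding has_nonneg_decomp_def by blast
  have "outer_prod (c h) (r h) \<in> box_outer_prods M" if h: "h \<in> {1..k}" for h
  proof (rule bounded_outer_prod_in_box)
    fix i j
    have "outer_prod (c h) (r h) $ i $ j \<le> (\<Sum>h=1..k. outer_prod (c h) (r h) $ i $ j)"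
      using h nn by (intro member_le_sum nonneg_outer_prod) auto
    also have "\<dots> = N $ i $ j" by (simp add: N)
    finally show "outer_prod (c h) (r h) $ i $ j \<le> M" using M order_trans by blast
  qed (use nn h in auto)
  then show ?thesis unfolding N by blast
qed

lemma box_sums_have_nonneg_decomp:
  fixes N :: "real ^ 'm ^ 'n"
  assumes "N \<in> {\<Sum>h=1..k. X h | X. \<forall>h\<in>{1..k}. X h \<in> box_outer_prods M}"
  shows "has_nonneg_decomp N k"
proof -
  obtain X where N: "N = (\<Sum>h=1..k. X h)" and X: "\<forall>h\<in>{1..k}. X h \<in> box_outer_prods M"
    using assms by blast
  have "\<exists>c r. nonneg_vec c \<and> nonneg_vec r \<and> X h = outer_prod c r" if "h \<in> {1..k}" for h
  proof -
    have "X h \<in> box_outer_prods M" using X that by blast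
    then obtain c r where "X h = outer_prod c r"
      and "c \<in> cbox 0 (\<chi> i. 1)" and "r \<in> cbox 0 (\<chi> j. M)"
      unfolding box_outer_prods_def by auto
    then show ?thesis
      by (intro exI[of _ c] exI[of _ r]) (simp add: nonneg_vec_def mem_box_cart)
  qed
  then obtain c r where
    cr: "\<And>h. h \<in> {1..k} \<Longrightarrow> nonneg_vec (c h) \<and> nonneg_vec (r h) \<and> X h = outer_prod (c h) (r h)"
    by metis
  then have "N = (\<Sum>h=1..k. outer_prod (c h) (r h))" unfolding N by (intro sum.cong) simp_all
  then show ?thesis unfolding has_nonneg_decomp_def using cr by blast
qed

lemma nonneg_ball_eq: "nonneg_ball P \<epsilon> = {N. nonneg_mat N \<and> dist P N < \<epsilon>}"
  by (simp add: nonneg_ball_def dist_norm norm_vec_def L2_set_def sum_nonneg)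

theorem theorem3p1:
  fixes P :: "real ^ 'm ^ 'n" and k :: nat
  assumes "nonneg_mat P"
    and "\<And>j. column j P \<noteq> 0"
    and "k = nonneg_rank P"
  shows "\<exists>\<epsilon>>0. \<forall>N\<in>nonneg_ball P \<epsilon>. nonneg_rank N \<ge> k"
proof -
  \<comment> \<open>This bounds all entries of every matrix within distance \<open>1\<close> of \<open>P\<close>.\<close>
  define M where "M = norm P + 1"
  define T :: "nat \<Rightarrow> (real ^ 'm ^ 'n) set" where
    "T l = {\<Sum>h=1..l. X h | X. \<forall>h\<in>{1..l}. X h \<in> box_outer_prods M}" for l
  have "closed (T l)" for l
    unfolding T_def by (rule compact_imp_closed[OF compact_indexed_sums[OF compact_box_outer_prods]])
  then have "closed (\<Union>l<k. T l)" by (intro closed_UN) auto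
  moreover have "P \<notin> (\<Union>l<k. T l)"
  proof
    assume "P \<in> (\<Union>l<k. T l)"
    then obtain l where l: "l < k" "P \<in> T l" by blast
    have "has_nonneg_decomp P l"
      using l(2) unfolding T_def by (rule box_sums_have_nonneg_decomp)
    then have "k \<le> l" unfolding assms(3) nonneg_rank_def by (rule Least_le)
    then show False using l(1) by simp
  qed
  ultimately have "\<exists>d>0. \<forall>N\<in>(\<Union>l<k. T l). d \<le> dist P N"
    by (rule separate_point_closed)
  then obtain d where d: "d > 0" "\<forall>N\<in>(\<Union>l<k. T l). d \<le> dist P N"
    by (elim exE conjE)
  have "nonneg_rank N \<ge> k" if N: "N \<in> nonneg_ball P (min d 1)" for N
  proof (rule ccontr)
    assume less: "\<not> nonneg_rank N \<ge> k"
    have nn: "nonneg_mat N" and dist: "dist P N < d" "dist P N < 1"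
      using N by (auto simp: nonneg_ball_eq)
    have "norm N \<le> M"
      using dist(2) norm_triangle_ineq2[of N P] by (simp add: M_def dist_norm norm_minus_commute)
    then have "N $ i $ j \<le> M" for i j
      using component_le_norm_cart[of "N $ i" j] Finite_Cartesian_Product.norm_nth_le[of N i] by simp
    moreover have "has_nonneg_decomp N (nonneg_rank N)"
      unfolding nonneg_rank_def by (rule LeastI) (rule nonneg_mat_has_decomp[OF nn])
    ultimately have "N \<in> T (nonneg_rank N)"
      unfolding T_def by (rule bounded_nonneg_decomp_in_box_sums[rotated])
    then have "N \<in> (\<Union>l<k. T l)" using less by (auto simp: not_le)
    then have "d \<le> dist P N" by (rule bspec[OF d(2)])
    then show False using dist(1) by simp
  qed
  then show ?thesis using d(1) by (intro exI[of _ "min d 1"]) auto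
qed

end
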